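(* Let $m \ge 2$ and $n\ge 1$, and let $\mathcal{A} = (a_{i_1\cdots i_m})$ be an $m$th order $n$-dimensional completely positive tensor. Let $(j_1,\dots,j_m)\in\mathcal{I}$, let $s\ge 1$, and suppose that $I=\{(i^{(1)}_1,\dots,i^{(1)}_m),\dots,(i^{(s)}_1,\dots,i^{(s)}_m)\}$ is an $s$-duplicate of $(j_1,\dots,j_m)$. Then $$\frac{1}{s}\sum_{p=1}^s a_{i^{(p)}_1\cdots i^{(p)}_m}\ \ge\ a_{j_1\cdots j_m}.$$
   Context: A real $m$th order $n$-dimensional tensor is an array $\mathcal{A} = (a_{i_1\cdots i_m})$ of real numbers indexed by $1\le i_1,\dots,i_m\le n$. For $u\in\mathbb{R}^n$, $u^m$ denotes the rank-one tensor $(u_{i_1}\cdots u_{i_m})$. $\mathbb{R}^n_+$ is the set of nonnegative vectors in $\mathbb{R}^n$. $\mathcal{A}$ is called completely positive (CP) if there are finitely many vectors $u^{(1)},\dots,u^{(r)}\in\mathbb{R}^n_+$ with $\mathcal{A}=\sum_{k=1}^r (u^{(k)})^m$. $\mathcal{I}=\{(i_1,\dots,i_m): 1\le i_k\le n,\ k=1,\dots,m\}$. For $(i_1,\dots,i_m)\in\mathcal{I}$, $[(i_1,\dots,i_m)]$ is the set of distinct members of $\{i_1,\dots,i_m\}$. Write $(i_1,\dots,i_m)\preceq(j_1,\dots,j_m)$ if $[(i_1,\dots,i_m)]\subseteq[(j_1,\dots,j_m)]$. For $(j_1,\dots,j_m)\in\mathcal{I}$, a family $I$ of $s$ elements $(i^{(p)}_1,\dots,i^{(p)}_m)\in\mathcal{I}$,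 $p=1,\dots,s$ (repetitions allowed), is an $s$-duplicate of $(j_1,\dots,j_m)$ if $(i^{(p)}_1,\dots,i^{(p)}_m)\preceq(j_1,\dots,j_m)$ for $p=1,\dots,s$, and every index $i\in\{j_1,\dots,j_m\}$ that appears exactly $t$ times in the list $j_1,\dots,j_m$ appears exactly $st$ times, in total, among all entries $i^{(p)}_q$ ($1\le p\le s$, $1\le q\le m$). *)

theory Defs
  imports "HOL-Analysis.Analysis"
begin

text \<open>
  The indices \<open>1, \<dots>, n\<close> are the elements of a finite type \<open>'n\<close>, so the dimension is \<open>CARD('n)\<close>.
  A multi-index of order \<open>m\<close> is a list of length \<open>m\<close> over \<open>'n\<close>. An \<open>m\<close>th order tensor is
  a function \<open>A\<close> on lists of which only the entries at lists of length \<open>m\<close> are meaningful.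
\<close>

type_synonym 'n tensor = "'n list \<Rightarrow> real"

definition multi_indices :: "nat \<Rightarrow> 'n::finite list set" where
  "multi_indices m = {js. length js = m}"

definition nonneg_vectors :: "(real ^ 'n::finite) set" where
  "nonneg_vectors = {u. \<forall>i. 0 \<le> u $ i}"

text \<open>The rank-one tensor \<open>u\<^sup>m\<close>; its order is the length of the list at which it is evaluated.\<close>

definition rank_one :: "real ^ 'n::finite \<Rightarrow> 'n tensor" where
  "rank_one u js = prod_list (map (($) u) js)"

definition completely_positive :: "nat \<Rightarrow> 'n::finite tensor \<Rightarrow> bool" where
  "completely_positive m A \<longleftrightarrow>
     (\<exists>(r::nat) (u :: nat \<Rightarrow> real ^ 'n).
        (\<forall>k\<in>{1..r}. u k \<in> nonneg_vectors) \<and>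
        (\<forall>js\<in>multi_indices m. A js = (\<Sum>k=1..r. rank_one (u k) js)))"

definition index_le :: "'n list \<Rightarrow> 'n list \<Rightarrow> bool" (infix "\<preceq>" 50) where
  "is \<preceq> js \<longleftrightarrow> set is \<subseteq> set js"

text \<open>The family is \<open>I 1, \<dots>, I s\<close>, repetitions allowed; \<open>I\<close> is unconstrained elsewhere.\<close>

definition is_duplicate :: "nat \<Rightarrow> nat \<Rightarrow> (nat \<Rightarrow> 'n::finite list) \<Rightarrow> 'n list \<Rightarrow> bool" where
  "is_duplicate m s I js \<longleftrightarrow>
     (\<forall>p\<in>{1..s}. I p \<in> multi_indices m \<and> I p \<preceq> js) \<and>
     (\<forall>i\<in>set js. (\<Sum>p=1..s. count_list (I p) i) = s * count_list js i)"

end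

theory Submission
  imports Defs
begin

text \<open>
  Both sides of the inequality are linear in the tensor, so it suffices to treat a single rank-one
  summand \<open>u\<^sup>m\<close> with \<open>u\<close> nonnegative. There the left-hand side is the arithmetic mean of the
  monomials \<open>\<Prod>\<^sub>q u\<^bsub>i\<^sub>q\<^esub>\<close> over the members of the duplicate. The counting condition says
  exactly that the product of these \<open>s\<close> monomials is the \<open>s\<close>th power of the monomial of
  \<open>js\<close>; hence their geometric mean is the entry at \<open>js\<close>, and the claim is the
  inequality between the arithmetic and the geometric mean.
\<close>

lemma prod_list_map_eq_prod_count:
  fixes f :: "'a \<Rightarrow> 'b::comm_monoid_mult"
  assumes "finite S" and "set xs \<subseteq> S"
  shows "prod_list (map f xs) = (\<Prod>i\<in>S. f i ^ count_list xs i)"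
  using assms(2)
proof (induction xs)
  case Nil
  show ?case by simp
next
  case (Cons x xs)
  have "(\<Prod>i\<in>S. f i ^ count_list (x # xs) i)
        = (\<Prod>i\<in>S. (if i = x then f i else 1) * f i ^ count_list xs i)"
    by (intro prod.cong) auto
  also have "\<dots> = f x * (\<Prod>i\<in>S. f i ^ count_list xs i)"
    using Cons.prems assms(1) by (simp add: prod.distrib)
  finally show ?case using Cons by simp
qed

lemma rank_one_nonneg:
  assumes "u \<in> nonneg_vectors"
  shows "0 \<le> rank_one u js"
  using assms unfolding rank_one_def nonneg_vectors_def by (induction js) auto

text \<open>
  Multiplying the entries adds up the exponents of each coordinate \<open>u\<^sub>i\<close>. Indices outside
  \<open>js\<close> cannot contribute, because every member of the duplicate is below \<open>js\<close>.
\<close>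

lemma prod_rank_one_duplicate:
  assumes "is_duplicate m s I js"
  shows "(\<Prod>p=1..s. rank_one u (I p)) = rank_one u js ^ s"
proof -
  have sub: "set (I p) \<subseteq> set js" if "p \<in> {1..s}" for p
    using assms that by (auto simp: is_duplicate_def index_le_def)
  have cnt: "(\<Sum>p=1..s. count_list (I p) i) = s * count_list js i" if "i \<in> set js" for i
    using assms that by (simp add: is_duplicate_def)
  have "(\<Prod>p=1..s. rank_one u (I p)) = (\<Prod>p=1..s. \<Prod>i\<in>set js. u $ i ^ count_list (I p) i)"
    unfolding rank_one_def using sub
    by (intro prod.cong refl prod_list_map_eq_prod_count) auto
  also have "\<dots> = (\<Prod>i\<in>set js. \<Prod>p=1..s. u $ i ^ count_list (I p) i)"
    by (rule prod.swap)
  also have "\<dots> = (\<Prod>i\<in>set js. (u $ i ^ count_list js i) ^ s)"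
    using cnt by (intro prod.cong refl) (simp add: power_sum[symmetric] power_mult[symmetric] mult.commute)
  also have "\<dots> = rank_one u js ^ s"
    unfolding rank_one_def prod_power_distrib[symmetric]
    by (subst prod_list_map_eq_prod_count[of "set js" js]) auto
  finally show ?thesis .
qed

text \<open>
  The inequality between the means in a form without roots: a geometric mean is recognised
  from its \<open>n\<close>th power.
\<close>

lemma le_arith_mean_if_prod_eq_power:
  fixes x :: "'a \<Rightarrow> real"
  assumes "finite S" "S \<noteq> {}" and "\<And>i. i \<in> S \<Longrightarrow> 0 \<le> x i"
    and "0 \<le> c" and "(\<Prod>i\<in>S. x i) = c ^ card S"
  shows "c \<le> (\<Sum>i\<in>S. x i) / card S"
proof -
  have "card S \<noteq> 0"
    using assms(1,2) by simp
  then have "(c ^ card S) powr (1 / card S) = c"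
    using \<open>0 \<le> c\<close> by (cases "c = 0") (simp_all add: powr_realpow[symmetric] powr_powr)
  then show ?thesis
    using arith_geom_mean[of S x] assms by (simp add: sum_divide_distrib)
qed

lemma rank_one_le_mean_duplicate:
  assumes "u \<in> nonneg_vectors" and "s \<ge> 1" and "is_duplicate m s I js"
  shows "rank_one u js \<le> (\<Sum>p=1..s. rank_one u (I p)) / real s"
  using le_arith_mean_if_prod_eq_power[of "{1..s}" "\<lambda>p. rank_one u (I p)" "rank_one u js"]
    prod_rank_one_duplicate[OF assms(3)] rank_one_nonneg[OF assms(1)] assms(2)
  by simp

theorem theorem4:
  fixes A :: "'n::finite tensor" and m s :: nat
    and js :: "'n list" and I :: "nat \<Rightarrow> 'n list"
  assumes "m \<ge> 2"
    and "completely_positive m A"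
    and "js \<in> multi_indices m"
    and "s \<ge> 1"
    and "is_duplicate m s I js"
  shows "(1 / real s) * (\<Sum>p=1..s. A (I p)) \<ge> A js"
proof -
  obtain r :: nat and u :: "nat \<Rightarrow> real ^ 'n"
    where u: "\<forall>k\<in>{1..r}. u k \<in> nonneg_vectors"
      and A: "\<forall>is\<in>multi_indices m. A is = (\<Sum>k=1..r. rank_one (u k) is)"
    using assms(2) unfolding completely_positive_def by blast
  have mem: "I p \<in> multi_indices m" if "p \<in> {1..s}" for p
    using assms(5) that by (simp add: is_duplicate_def)
  have "A js = (\<Sum>k=1..r. rank_one (u k) js)"
    using A assms(3) by blast
  also have "\<dots> \<le> (\<Sum>k=1..r. (\<Sum>p=1..s. rank_one (u k) (I p)) / real s)"
    using u rank_one_le_mean_duplicate[OF _ assms(4,5)] by (intro sum_mono) auto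
  also have "\<dots> = (\<Sum>p=1..s. \<Sum>k=1..r. rank_one (u k) (I p)) / real s"
    by (subst sum.swap) (simp add: sum_divide_distrib)
  also have "\<dots> = (\<Sum>p=1..s. A (I p)) / real s"
    using A mem by simp
  finally show ?thesis by simp
qed

end
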